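(* Let $F:\mathbb{R}^n\to\mathbb{R}^n$ be continuously differentiable with Jacobian $J$. Suppose there is $L>0$ such that $\|J(x)-J(y)\|\le L\|x-y\|$ for all $x,y\in\mathbb{R}^n$, and suppose $J$ satisfies the one-sided Lipschitz condition: there are a constant vector $c\in\mathbb{R}^n$ with $c^TF(x)=0$ for all $x\in\mathbb{R}^n$ and a number $\nu>0$ such that, for all $x\in\mathbb{R}^n$, $$y^TJ(x)y\le-\nu\|y\|^2\quad\text{for all } y\in S_c=\{y\in\mathbb{R}^n: c^Ty=0\}.$$ Let $\{x_k\}$ be a sequence generated by the CNMTr algorithm (described in the context). Then $$\liminf_{k\to\infty}\|F(x_k)\|=0.$$
   Context: $\|\cdot\|$ is the Euclidean norm on vectors and its induced norm on matrices; $J(x)=\partial F(x)/\partial x$; $I$ is the identity matrix. CNMTr algorithm. Constants: $\eta_a=10^{-6}$, $\eta_1=0.25$, $\eta_2=0.75$, $\gamma_1=2$, $\gamma_2=0.5$, and a small positive constant $c_\epsilon$. Given a starting point $x_0\in\mathbb{R}^n$ and $\Delta t_0=10^{-2}$, for $k=0,1,2,\ldots$: 1. If $k=0$ or the previous trial step was accepted, let $s_k^P$ be the solution of $(\mu_k I-J(x_k))s_k^P=F(x_k)$, where $\mu_k=c_\epsilon$ if $\Delta t_k\le 1/c_\epsilon$ and $\mu_k=1/\Delta t_k$ otherwise. If the previous trial step was rejected, $s_k^P=s_{k-1}^P$ is reused. 2. Set $s_k=\frac{\Delta t_k}{1+\Delta t_k}s_k^P$; the trial point is $x_k+s_k$.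 3. If $\|F(x_k)\|<\|F(x_k)+J(x_k)s_k\|$ set $\rho_k=-1$; otherwise set $\rho_k=\dfrac{\|F(x_k)\|-\|F(x_k+s_k)\|}{\|F(x_k)\|-\|F(x_k)+J(x_k)s_k\|}$. 4. Set $\Delta t_{k+1}=\gamma_1\Delta t_k$ if $|1-\rho_k|\le\eta_1$; $\Delta t_{k+1}=\Delta t_k$ if $\eta_1<|1-\rho_k|<\eta_2$; $\Delta t_{k+1}=\gamma_2\Delta t_k$ otherwise. 5. If $\rho_k\ge\eta_a$, accept: $x_{k+1}=x_k+s_k$. Otherwise reject: $x_{k+1}=x_k$. The iteration stops only if $F(x_k)=0$; asymptotic statements concern the case in which an infinite sequence is generated. *)

theory Defs
  imports "HOL-Analysis.Analysis"
begin

text \<open>Induced (spectral) norm. The library norm on the type of matrices is the Frobenius norm,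
  so it is not used here.\<close>

definition matrix_norm :: "real^'n^'m \<Rightarrow> real" where
  "matrix_norm A = onorm (\<lambda>v. A *v v)"

definition one_sided_lipschitz ::
    "(real^'n \<Rightarrow> real^'n) \<Rightarrow> (real^'n \<Rightarrow> real^'n^'n) \<Rightarrow> bool" where
  "one_sided_lipschitz F J \<longleftrightarrow>
     (\<exists>c. \<exists>\<nu>>0. (\<forall>x. c \<bullet> F x = 0) \<and>
        (\<forall>x. \<forall>y\<in>{y. c \<bullet> y = 0}. y \<bullet> (J x *v y) \<le> - \<nu> * (norm y)\<^sup>2))"

definition \<eta>\<^sub>a :: real where "\<eta>\<^sub>a = 1 / 10 ^ 6"
definition \<eta>\<^sub>1 :: real where "\<eta>\<^sub>1 = 1 / 4"
definition \<eta>\<^sub>2 :: real where "\<eta>\<^sub>2 = 3 / 4"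
definition \<gamma>\<^sub>1 :: real where "\<gamma>\<^sub>1 = 2"
definition \<gamma>\<^sub>2 :: real where "\<gamma>\<^sub>2 = 1 / 2"
definition initial_dt :: real where "initial_dt = 1 / 10 ^ 2"

definition regularization :: "real \<Rightarrow> real \<Rightarrow> real" where
  "regularization c\<epsilon> dt = (if dt \<le> 1 / c\<epsilon> then c\<epsilon> else 1 / dt)"

definition reduction_ratio ::
    "(real^'n \<Rightarrow> real^'n) \<Rightarrow> (real^'n \<Rightarrow> real^'n^'n) \<Rightarrow> real^'n \<Rightarrow> real^'n \<Rightarrow> real" where
  "reduction_ratio F J x s =
     (if norm (F x) < norm (F x + J x *v s) then - 1
      else (norm (F x) - norm (F (x + s))) / (norm (F x) - norm (F x + J x *v s)))"

definition next_dt :: "real \<Rightarrow> real \<Rightarrow> real" where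
  "next_dt \<rho> dt =
     (if \<bar>1 - \<rho>\<bar> \<le> \<eta>\<^sub>1 then \<gamma>\<^sub>1 * dt
      else if \<bar>1 - \<rho>\<bar> < \<eta>\<^sub>2 then dt
      else \<gamma>\<^sub>2 * dt)"

definition accepted :: "real \<Rightarrow> bool" where
  "accepted \<rho> \<longleftrightarrow> \<rho> \<ge> \<eta>\<^sub>a"

text \<open>Infinite runs of the algorithm. The condition that \<open>F\<close> does not vanish along the run
  expresses that the stopping test never succeeds. The iterates include those following rejected
  trial steps, where \<open>x (k + 1) = x k\<close>.\<close>

definition CNMTr_run ::
    "real \<Rightarrow> (real^'n \<Rightarrow> real^'n) \<Rightarrow> (real^'n \<Rightarrow> real^'n^'n) \<Rightarrow> real^'n \<Rightarrow>
     (nat \<Rightarrow> real^'n) \<Rightarrow> (nat \<Rightarrow> real^'n) \<Rightarrow> (nat \<Rightarrow> real^'n) \<Rightarrow>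
     (nat \<Rightarrow> real) \<Rightarrow> (nat \<Rightarrow> real) \<Rightarrow> bool" where
  "CNMTr_run c\<epsilon> F J x\<^sub>0 x sP s dt \<rho> \<longleftrightarrow>
     x 0 = x\<^sub>0 \<and> dt 0 = initial_dt \<and>
     (\<forall>k. F (x k) \<noteq> 0 \<and>
        (if k = 0 \<or> accepted (\<rho> (k - 1))
         then (regularization c\<epsilon> (dt k) *\<^sub>R mat 1 - J (x k)) *v sP k = F (x k)
         else sP k = sP (k - 1)) \<and>
        s k = (dt k / (1 + dt k)) *\<^sub>R sP k \<and>
        \<rho> k = reduction_ratio F J (x k) (s k) \<and>
        dt (k + 1) = next_dt (\<rho> k) (dt k) \<and>
        x (k + 1) = (if accepted (\<rho> k) then x k + s k else x k))"

definition CNMTr_sequence ::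
    "real \<Rightarrow> (real^'n \<Rightarrow> real^'n) \<Rightarrow> (real^'n \<Rightarrow> real^'n^'n) \<Rightarrow> real^'n \<Rightarrow>
     (nat \<Rightarrow> real^'n) \<Rightarrow> bool" where
  "CNMTr_sequence c\<epsilon> F J x\<^sub>0 x \<longleftrightarrow> (\<exists>sP s dt \<rho>. CNMTr_run c\<epsilon> F J x\<^sub>0 x sP s dt \<rho>)"

end

theory Submission
  imports Defs
begin

text \<open>
  The conservation law \<open>c \<bullet> F = 0\<close> differentiates to \<open>c \<bullet> (J z *v h) = 0\<close>.  Hence a solution \<open>p\<close> of
  \<open>(m *\<^sub>R mat 1 - J x) *v p = F x\<close> with \<open>m > 0\<close> is itself orthogonal to \<open>c\<close>, so the one-sided
  Lipschitz condition applies to \<open>p\<close> and gives \<open>(m + \<nu>) * norm p \<le> norm (F x)\<close>.  Everything else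
  follows from this estimate.  Since \<open>J x *v p = m *\<^sub>R p - F x\<close>, the linear model at the damped step
  \<open>t *\<^sub>R p\<close> is a convex combination of \<open>F x\<close> and \<open>m *\<^sub>R p\<close>, and it predicts a reduction of
  at least \<open>t * \<nu> / (m + \<nu>) * norm (F x)\<close> (\<open>predicted_reduction_bound\<close>).  The error of the model is of
  order \<open>t\<^sup>2\<close> because \<open>J\<close> is Lipschitz, so \<open>\<bar>1 - \<rho>\<bar>\<close> is at most a constant times \<open>t\<close>
  (\<open>ratio_deviation_bound\<close>).

  What remains is an argument about real sequences (\<open>residual_tendsto_zero\<close>).  A step size below a
  fixed threshold is doubled, so the step sizes stay away from zero.  A rejected step halves the step
  size, so infinitely many steps are accepted.  Each accepted step removes at least a fixed fraction
  of the residual, and the residual never increases; so it tends to zero.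

  A step that is reused after a rejection was computed with an earlier regularization parameter, but
  at the same iterate.  The bound on \<open>\<bar>1 - \<rho>\<bar>\<close> does not involve \<open>m\<close>, and the bound on the reduction is
  weakest at the largest possible value \<open>m = c\<epsilon>\<close>; so it suffices to know that some parameter in
  \<open>{0<..c\<epsilon>}\<close> belongs to the current step.
\<close>

section \<open>The damped regularized Newton step\<close>

lemma conserved_imp_derivative_orthogonal:
  fixes F :: "real^'n \<Rightarrow> real^'n"
  assumes "(F has_derivative F') (at z)" and "\<And>x. c \<bullet> F x = 0"
  shows "c \<bullet> F' h = 0"
proof -
  have "((\<lambda>x. c \<bullet> F x) has_derivative (\<lambda>h. c \<bullet> F' h)) (at z)"
    using assms(1) by (rule has_derivative_inner_right)
  moreover have "((\<lambda>x. c \<bullet> F x) has_derivative (\<lambda>h. 0)) (at z)"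
    using assms(2) by simp
  ultimately show ?thesis
    by (rule has_derivative_unique[THEN fun_cong])
qed

text \<open>The derivative of \<open>F\<close> varies by at most \<open>L * norm s\<close> on the ball of radius \<open>norm s\<close>, so the
  mean value inequality applies there.  The sharp constant is \<open>L / 2\<close>; only the order in \<open>s\<close>
  matters later.\<close>

lemma linearization_error_bound:
  fixes F :: "real^'n \<Rightarrow> real^'m" and J :: "real^'n \<Rightarrow> real^'n^'m"
  assumes der: "\<And>z. (F has_derivative (\<lambda>h. J z *v h)) (at z)"
    and lip: "\<And>y z. matrix_norm (J y - J z) \<le> L * norm (y - z)" and "L \<ge> 0"
  shows "norm (F (x + s) - (F x + J x *v s)) \<le> L * (norm s)\<^sup>2"
proof -
  have "norm (F (x + s) - F x - J x *v ((x + s) - x)) \<le> norm ((x + s) - x) * (L * norm s)"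
  proof (rule differentiable_bound_linearization[where S = "cball x (norm s)"
        and f' = "\<lambda>z h. J z *v h"])
    fix z
    assume z: "z \<in> cball x (norm s)"
    have "onorm ((*v) (J z) - (*v) (J x)) = matrix_norm (J z - J x)"
      unfolding matrix_norm_def
      by (rule arg_cong[where f = onorm]) (auto simp: matrix_vector_mult_diff_rdistrib)
    also have "\<dots> \<le> L * norm (z - x)"
      by (rule lip)
    also have "\<dots> \<le> L * norm s"
      using z \<open>L \<ge> 0\<close> by (intro mult_left_mono) (auto simp: dist_norm norm_minus_commute)
    finally show "onorm ((*v) (J z) - (*v) (J x)) \<le> L * norm s" .
  next
    fix t :: real
    assume "t \<in> {0..1}"
    then show "x + t *\<^sub>R ((x + s) - x) \<in> cball x (norm s)"
      by (auto simp: dist_norm intro: mult_left_le_one_le)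
  qed (auto intro: has_derivative_at_withinI[OF der])
  then show ?thesis
    by (simp add: power2_eq_square algebra_simps)
qed

text \<open>Pairing the defining equation with \<open>c\<close> leaves \<open>m * (c \<bullet> p) = 0\<close>, which puts \<open>p\<close> in the
  subspace where \<open>A\<close> is negative definite; pairing it with \<open>p\<close> then gives the bound.\<close>

lemma regularized_step_bound:
  fixes A :: "real^'n^'n"
  assumes neg: "\<And>y. c \<bullet> y = 0 \<Longrightarrow> y \<bullet> (A *v y) \<le> - \<nu> * (norm y)\<^sup>2"
    and orth: "\<And>h. c \<bullet> (A *v h) = 0" and "c \<bullet> f = 0"
    and "m > 0" and "\<nu> > 0"
    and p: "(m *\<^sub>R mat 1 - A) *v p = f"
  shows "(m + \<nu>) * norm p \<le> norm f"
proof -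
  have f: "f = m *\<^sub>R p - A *v p"
    using p by (simp add: matrix_vector_mult_diff_rdistrib scaleR_matrix_vector_assoc[symmetric])
  have "c \<bullet> p = 0"
    using \<open>c \<bullet> f = 0\<close> \<open>m > 0\<close> orth[of p] unfolding f by (simp add: inner_diff_right)
  then have "p \<bullet> (A *v p) \<le> - \<nu> * (norm p)\<^sup>2"
    by (rule neg)
  then have "(m + \<nu>) * (norm p)\<^sup>2 \<le> p \<bullet> f"
    unfolding f by (simp add: inner_diff_right power2_norm_eq_inner algebra_simps)
  also have "\<dots> \<le> norm p * norm f"
    by (rule norm_cauchy_schwarz)
  finally have "norm p * ((m + \<nu>) * norm p) \<le> norm p * norm f"
    by (simp add: power2_eq_square algebra_simps)
  then show ?thesis
    by (cases "p = 0") auto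
qed

lemma predicted_reduction_bound:
  fixes A :: "real^'n^'n"
  assumes p: "(m *\<^sub>R mat 1 - A) *v p = f"
    and bound: "(m + \<nu>) * norm p \<le> norm f"
    and "m > 0" and "\<nu> > 0" and "0 \<le> t" and "t \<le> 1"
  shows "t * \<nu> / (m + \<nu>) * norm f \<le> norm f - norm (f + A *v (t *\<^sub>R p))"
proof -
  have A: "A *v p = m *\<^sub>R p - f"
    using p by (auto simp: matrix_vector_mult_diff_rdistrib scaleR_matrix_vector_assoc[symmetric])
  have "f + A *v (t *\<^sub>R p) = (1 - t) *\<^sub>R f + (t * m) *\<^sub>R p"
    by (simp add: matrix_vector_mult_scaleR A algebra_simps)
  then have "norm (f + A *v (t *\<^sub>R p)) \<le> (1 - t) * norm f + t * m * norm p"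
    using norm_triangle_ineq[of "(1 - t) *\<^sub>R f" "(t * m) *\<^sub>R p"] assms by simp
  also have "t * m * norm p \<le> t * m * (norm f / (m + \<nu>))"
    using bound assms by (intro mult_left_mono) (auto simp: field_simps)
  also have "(1 - t) * norm f + t * m * (norm f / (m + \<nu>)) = norm f - t * \<nu> / (m + \<nu>) * norm f"
    using \<open>m > 0\<close> \<open>\<nu> > 0\<close> by (simp add: field_simps)
  finally show ?thesis
    by simp
qed

section \<open>Quality of the linear model\<close>

text \<open>The predicted reduction is positive, so the ratio is a genuine quotient, and its distance from
  one is the model error over the predicted reduction, which are of order \<open>t\<^sup>2\<close> and \<open>t\<close>.\<close>

lemma ratio_deviation_bound:
  fixes F :: "real^'n \<Rightarrow> real^'n"
  assumes p: "(m *\<^sub>R mat 1 - J x) *v p = F x"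
    and bound: "(m + \<nu>) * norm p \<le> norm (F x)"
    and err: "norm (F (x + t *\<^sub>R p) - (F x + J x *v (t *\<^sub>R p))) \<le> L * (norm (t *\<^sub>R p))\<^sup>2"
    and "m > 0" and "\<nu> > 0" and "L \<ge> 0" and t: "0 < t" "t \<le> 1" and nz: "F x \<noteq> 0"
  shows "\<bar>1 - reduction_ratio F J x (t *\<^sub>R p)\<bar> \<le> L / \<nu>\<^sup>2 * norm (F x) * t"
proof -
  let ?f = "norm (F x)"
  define pred where "pred = ?f - norm (F x + J x *v (t *\<^sub>R p))"
  have pred: "t * \<nu> / (m + \<nu>) * ?f \<le> pred"
    unfolding pred_def using assms by (intro predicted_reduction_bound) auto
  have "0 < t * \<nu> / (m + \<nu>) * ?f"
    using assms by simp
  with pred have "0 < pred"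
    by (rule less_le_trans[rotated])
  have "m + \<nu> > 0"
    using \<open>m > 0\<close> \<open>\<nu> > 0\<close> by simp
  have "norm p \<le> ?f / (m + \<nu>)"
    using bound \<open>m > 0\<close> \<open>\<nu> > 0\<close> by (simp add: field_simps)
  then have sq: "(norm p)\<^sup>2 \<le> (?f / (m + \<nu>))\<^sup>2"
    by (intro power_mono) auto
  have "reduction_ratio F J x (t *\<^sub>R p) = (?f - norm (F (x + t *\<^sub>R p))) / pred"
    using \<open>0 < pred\<close> unfolding reduction_ratio_def pred_def by simp
  then have "1 - reduction_ratio F J x (t *\<^sub>R p)
      = (norm (F (x + t *\<^sub>R p)) - norm (F x + J x *v (t *\<^sub>R p))) / pred"
    using \<open>0 < pred\<close> by (simp add: pred_def field_simps)
  then have "\<bar>1 - reduction_ratio F J x (t *\<^sub>R p)\<bar>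
      = \<bar>norm (F (x + t *\<^sub>R p)) - norm (F x + J x *v (t *\<^sub>R p))\<bar> / pred"
    using \<open>0 < pred\<close> by simp
  also have "\<dots> \<le> (L * (norm (t *\<^sub>R p))\<^sup>2) / pred"
    using \<open>0 < pred\<close> norm_triangle_ineq3 by (intro divide_right_mono order.trans[OF _ err]) auto
  also have "\<dots> \<le> (L * (t\<^sup>2 * (?f / (m + \<nu>))\<^sup>2)) / (t * \<nu> / (m + \<nu>) * ?f)"
    using pred \<open>0 < t * \<nu> / (m + \<nu>) * ?f\<close> sq \<open>L \<ge> 0\<close>
    by (intro frac_le) (auto simp: power_mult_distrib intro!: mult_left_mono)
  also have "\<dots> = L * ?f * t / (\<nu> * (m + \<nu>))"
    using \<open>m + \<nu> > 0\<close> \<open>\<nu> > 0\<close> t nz by (simp add: divide_simps power2_eq_square)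
  also have "\<dots> \<le> L * ?f * t / (\<nu> * \<nu>)"
    using assms by (intro divide_left_mono mult_left_mono) auto
  finally show ?thesis
    by (simp add: power2_eq_square mult_ac)
qed

lemma actual_reduction_bound:
  fixes F :: "real^'n \<Rightarrow> real^'n"
  assumes p: "(m *\<^sub>R mat 1 - J x) *v p = F x"
    and bound: "(m + \<nu>) * norm p \<le> norm (F x)"
    and "m > 0" and "\<nu> > 0" and t: "0 < t" "t \<le> 1" and nz: "F x \<noteq> 0"
    and r: "r \<ge> 0" "reduction_ratio F J x (t *\<^sub>R p) \<ge> r"
  shows "r * (t * \<nu> / (m + \<nu>) * norm (F x)) \<le> norm (F x) - norm (F (x + t *\<^sub>R p))"
proof -
  define pred where "pred = norm (F x) - norm (F x + J x *v (t *\<^sub>R p))"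
  have pred: "t * \<nu> / (m + \<nu>) * norm (F x) \<le> pred"
    unfolding pred_def using assms by (intro predicted_reduction_bound) auto
  have pos: "0 < t * \<nu> / (m + \<nu>) * norm (F x)"
    using assms by simp
  have "reduction_ratio F J x (t *\<^sub>R p) = (norm (F x) - norm (F (x + t *\<^sub>R p))) / pred"
    using pred pos unfolding reduction_ratio_def pred_def by auto
  then have "r * pred \<le> norm (F x) - norm (F (x + t *\<^sub>R p))"
    using r(2) pred pos by (simp add: pos_le_divide_eq)
  moreover have "r * (t * \<nu> / (m + \<nu>) * norm (F x)) \<le> r * pred"
    using pred r(1) by (rule mult_left_mono)
  ultimately show ?thesis
    by linarith
qed

section \<open>Step size control\<close>

lemma regularization_bounds:
  assumes "c\<epsilon> > 0" and "dt > 0"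
  shows "0 < regularization c\<epsilon> dt" and "regularization c\<epsilon> dt \<le> c\<epsilon>"
  using assms by (auto simp: regularization_def field_simps)

lemma next_dt_pos: "dt > 0 \<Longrightarrow> next_dt \<rho> dt > 0"
  by (simp add: next_dt_def \<gamma>\<^sub>1_def \<gamma>\<^sub>2_def)

text \<open>Rejection means \<open>\<rho> < \<eta>\<^sub>a\<close>, hence \<open>1 - \<rho> > 1 - \<eta>\<^sub>a > \<eta>\<^sub>2\<close>.\<close>

lemma rejected_imp_halved: "\<not> accepted \<rho> \<Longrightarrow> next_dt \<rho> dt = dt / 2"
  by (auto simp: accepted_def next_dt_def \<eta>\<^sub>a_def \<eta>\<^sub>1_def \<eta>\<^sub>2_def \<gamma>\<^sub>2_def)

text \<open>A step size is halved only if \<open>\<bar>1 - \<rho>\<bar>\<close> exceeds \<open>1 / 4\<close>, that is, only if the step size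
  itself is above \<open>1 / (4 * C)\<close>; so a halving never leads below half of that threshold.\<close>

lemma step_size_bounded_below:
  fixes dt :: "nat \<Rightarrow> real"
  assumes pos: "\<And>k. dt k > 0" and "C > 0"
    and dev: "\<And>k. \<bar>1 - \<rho> k\<bar> \<le> C * dt k"
    and upd: "\<And>k. dt (Suc k) = next_dt (\<rho> k) (dt k)"
  shows "min (dt 0) (1 / (8 * C)) \<le> dt k"
proof (induction k)
  case (Suc k)
  show ?case
  proof (cases "\<bar>1 - \<rho> k\<bar> \<le> 1 / 4")
    case True
    then have "dt (Suc k) = 2 * dt k"
      by (simp add: upd next_dt_def \<eta>\<^sub>1_def \<gamma>\<^sub>1_def)
    then show ?thesis
      using Suc pos[of k] by linarith
  next
    case False
    then have "1 / 4 < C * dt k"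
      using dev[of k] by linarith
    then have "1 / (8 * C) \<le> dt k / 2"
      using \<open>C > 0\<close> by (simp add: field_simps)
    moreover have "dt k / 2 \<le> dt (Suc k)"
      using False pos[of k] by (simp add: upd next_dt_def \<eta>\<^sub>1_def \<gamma>\<^sub>2_def)
    ultimately show ?thesis
      by linarith
  qed
qed simp

text \<open>The residuals \<open>g\<close> decrease to a limit \<open>l\<close>.  If \<open>l\<close> were positive, each accepted step would
  lower \<open>g\<close> by a fixed amount, which convergence permits only finitely often; but then the step
  size would be halved forever.\<close>

lemma residual_tendsto_zero:
  fixes g dt \<rho> :: "nat \<Rightarrow> real"
  assumes pos: "\<And>k. dt k > 0" and g: "\<And>k. g k > 0" and "K > 0" and "\<beta> > 0"
    and upd: "\<And>k. dt (Suc k) = next_dt (\<rho> k) (dt k)"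
    and dev: "\<And>k. \<bar>1 - \<rho> k\<bar> \<le> K * g k * (dt k / (1 + dt k))"
    and gain: "\<And>k. accepted (\<rho> k) \<Longrightarrow> \<beta> * (dt k / (1 + dt k)) * g k \<le> g k - g (Suc k)"
    and rej: "\<And>k. \<not> accepted (\<rho> k) \<Longrightarrow> g (Suc k) = g k"
  shows "g \<longlonglongrightarrow> 0"
proof -
  have "g (Suc k) \<le> g k" for k
  proof (cases "accepted (\<rho> k)")
    case True
    moreover have "0 \<le> \<beta> * (dt k / (1 + dt k)) * g k"
      using pos[of k] g[of k] \<open>\<beta> > 0\<close> by simp
    ultimately show ?thesis
      using gain[of k] by linarith
  qed (simp add: rej)
  then have dec: "decseq g"
    by (rule decseq_SucI)
  obtain l where l: "g \<longlonglongrightarrow> l" "\<And>k. l \<le> g k"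
    using decseq_convergent[OF dec] g by (metis less_imp_le)
  have "0 \<le> l"
    using l(1) g by (intro LIMSEQ_le_const) (auto intro: less_imp_le)
  define d where "d = min (dt 0) (1 / (8 * (K * g 0)))"
  have "\<bar>1 - \<rho> k\<bar> \<le> K * g 0 * dt k" for k
  proof -
    have "K * g k * (dt k / (1 + dt k)) \<le> K * g 0 * dt k"
      using decseqD[OF dec, of 0 k] pos[of k] g[of k] g[of 0] \<open>K > 0\<close>
      by (intro mult_mono) (auto simp: field_simps)
    then show ?thesis
      using dev[of k] by linarith
  qed
  then have d: "d \<le> dt k" for k
    unfolding d_def using pos g \<open>K > 0\<close> upd by (intro step_size_bounded_below) auto
  have "d > 0"
    unfolding d_def using pos g \<open>K > 0\<close> by simp
  have "l = 0"
  proof (rule ccontr)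
    assume "l \<noteq> 0"
    with \<open>0 \<le> l\<close> have "l > 0" by simp
    define \<delta> where "\<delta> = \<beta> * (d / (1 + d)) * l"
    have "\<delta> > 0"
      unfolding \<delta>_def using \<open>\<beta> > 0\<close> \<open>d > 0\<close> \<open>l > 0\<close> by simp
    have "(\<lambda>k. g k - g (Suc k)) \<longlonglongrightarrow> 0"
      using tendsto_diff[OF l(1) LIMSEQ_Suc[OF l(1)]] by simp
    then have "eventually (\<lambda>k. g k - g (Suc k) < \<delta>) sequentially"
      using \<open>\<delta> > 0\<close> by (rule order_tendstoD)
    then obtain N where N: "\<And>k. k \<ge> N \<Longrightarrow> g k - g (Suc k) < \<delta>"
      unfolding eventually_sequentially by blast
    have rejected: "\<not> accepted (\<rho> k)" if "k \<ge> N" for k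
    proof
      assume "accepted (\<rho> k)"
      have "d / (1 + d) \<le> dt k / (1 + dt k)"
        using d[of k] \<open>d > 0\<close> pos[of k] by (simp add: field_simps)
      then have "\<delta> \<le> \<beta> * (dt k / (1 + dt k)) * g k"
        unfolding \<delta>_def using l(2)[of k] \<open>\<beta> > 0\<close> \<open>d > 0\<close> \<open>l > 0\<close> pos[of k]
        by (intro mult_mono mult_left_mono) auto
      then show False
        using gain[OF \<open>accepted (\<rho> k)\<close>] N[OF that] by linarith
    qed
    have "dt (N + j) = dt N * (1 / 2) ^ j" for j
      by (induction j) (simp_all add: upd rejected_imp_halved rejected)
    moreover have "(\<lambda>j. dt N * (1 / 2) ^ j) \<longlonglongrightarrow> 0"
      by (intro tendsto_mult_right_zero LIMSEQ_power_zero) simp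
    ultimately have "(\<lambda>j. dt (N + j)) \<longlonglongrightarrow> 0"
      by simp
    then have "d \<le> 0"
      by (rule LIMSEQ_le_const) (use d in auto)
    with \<open>d > 0\<close> show False by simp
  qed
  with l show ?thesis by simp
qed

section \<open>Convergence of the residuals\<close>

text \<open>After a rejection both the iterate and the step are unchanged, so the old parameter still
  fits.\<close>

lemma CNMTr_step_parameter:
  assumes "CNMTr_run c\<epsilon> F J x\<^sub>0 x sP s dt \<rho>" and "c\<epsilon> > 0" and pos: "\<And>k. dt k > 0"
  shows "\<exists>m>0. m \<le> c\<epsilon> \<and> (m *\<^sub>R mat 1 - J (x k)) *v sP k = F (x k)"
proof (induction k)
  case 0
  have "(regularization c\<epsilon> (dt 0) *\<^sub>R mat 1 - J (x 0)) *v sP 0 = F (x 0)"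
    using assms(1) unfolding CNMTr_run_def by (metis (no_types))
  then show ?case
    using regularization_bounds[OF \<open>c\<epsilon> > 0\<close> pos[of 0]] by blast
next
  case (Suc k)
  have step: "if accepted (\<rho> k)
      then (regularization c\<epsilon> (dt (Suc k)) *\<^sub>R mat 1 - J (x (Suc k))) *v sP (Suc k) = F (x (Suc k))
      else sP (Suc k) = sP k \<and> x (Suc k) = x k"
    using assms(1) unfolding CNMTr_run_def
    by (metis (no_types, lifting) Suc_eq_plus1 diff_Suc_1 nat.distinct(1))
  show ?case
  proof (cases "accepted (\<rho> k)")
    case True
    then show ?thesis
      using step regularization_bounds[OF \<open>c\<epsilon> > 0\<close> pos[of "Suc k"]] by auto
  next
    case False
    then show ?thesis
      using step Suc by auto
  qed
qed

theorem theorem3: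
  fixes F :: "real^'n \<Rightarrow> real^'n"
    and J :: "real^'n \<Rightarrow> real^'n^'n"
    and c\<epsilon> :: real
    and x\<^sub>0 :: "real^'n"
    and x :: "nat \<Rightarrow> real^'n"
  assumes "\<And>z. (F has_derivative (\<lambda>h. J z *v h)) (at z)"
    and "continuous_on UNIV J"
    and "\<exists>L>0. \<forall>y z. matrix_norm (J y - J z) \<le> L * norm (y - z)"
    and "one_sided_lipschitz F J"
    and "c\<epsilon> > 0"
    and "CNMTr_sequence c\<epsilon> F J x\<^sub>0 x"
  shows "liminf (\<lambda>k. ereal (norm (F (x k)))) = 0"
proof -
  obtain L where L: "L > 0" "\<And>y z. matrix_norm (J y - J z) \<le> L * norm (y - z)"
    using assms(3) by blast
  obtain c \<nu> where "\<nu> > 0" and cF: "\<And>z. c \<bullet> F z = 0"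
    and neg: "\<And>z y. c \<bullet> y = 0 \<Longrightarrow> y \<bullet> (J z *v y) \<le> - \<nu> * (norm y)\<^sup>2"
    using assms(4) unfolding one_sided_lipschitz_def by blast
  obtain sP s dt \<rho> where run: "CNMTr_run c\<epsilon> F J x\<^sub>0 x sP s dt \<rho>"
    using assms(6) unfolding CNMTr_sequence_def by blast
  have nz: "F (x k) \<noteq> 0"
    and s: "s k = (dt k / (1 + dt k)) *\<^sub>R sP k"
    and \<rho>: "\<rho> k = reduction_ratio F J (x k) (s k)"
    and upd: "dt (Suc k) = next_dt (\<rho> k) (dt k)"
    and x: "x (Suc k) = (if accepted (\<rho> k) then x k + s k else x k)" for k
    using run by (simp_all add: CNMTr_run_def)
  have dt0: "dt 0 = initial_dt"
    using run by (simp add: CNMTr_run_def)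
  have pos: "dt k > 0" for k
    by (induction k) (simp_all add: dt0 initial_dt_def upd next_dt_pos)
  have t: "0 < dt k / (1 + dt k)" "dt k / (1 + dt k) \<le> 1" for k
    using pos[of k] by simp_all
  have orth: "c \<bullet> (J z *v h) = 0" for z h
    by (rule conserved_imp_derivative_orthogonal[OF assms(1) cF])
  have "\<exists>m. 0 < m \<and> m \<le> c\<epsilon> \<and> (m *\<^sub>R mat 1 - J (x k)) *v sP k = F (x k)" for k
    using CNMTr_step_parameter[OF run \<open>c\<epsilon> > 0\<close> pos] .
  then obtain m where m: "\<And>k. 0 < m k" "\<And>k. m k \<le> c\<epsilon>"
      "\<And>k. (m k *\<^sub>R mat 1 - J (x k)) *v sP k = F (x k)"
    by metis
  have bound: "(m k + \<nu>) * norm (sP k) \<le> norm (F (x k))" for k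
    using regularized_step_bound[OF neg orth cF m(1) \<open>\<nu> > 0\<close> m(3)] .
  have "(\<lambda>k. norm (F (x k))) \<longlonglongrightarrow> 0"
  proof (rule residual_tendsto_zero[where dt = dt and \<rho> = \<rho> and K = "L / \<nu>\<^sup>2"
        and \<beta> = "\<eta>\<^sub>a * (\<nu> / (c\<epsilon> + \<nu>))"])
    fix k
    show "\<bar>1 - \<rho> k\<bar> \<le> L / \<nu>\<^sup>2 * norm (F (x k)) * (dt k / (1 + dt k))"
      unfolding \<rho> s
      using L(1) \<open>\<nu> > 0\<close> t nz m(1) linearization_error_bound[OF assms(1) L(2)]
      by (intro ratio_deviation_bound[where F = F and J = J and x = "x k", OF m(3) bound])
           (blast intro: less_imp_le)+
    show "\<eta>\<^sub>a * (\<nu> / (c\<epsilon> + \<nu>)) * (dt k / (1 + dt k)) * norm (F (x k))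
        \<le> norm (F (x k)) - norm (F (x (Suc k)))" if "accepted (\<rho> k)"
    proof -
      let ?t = "dt k / (1 + dt k)"
      have "\<nu> / (c\<epsilon> + \<nu>) \<le> \<nu> / (m k + \<nu>)"
        using m(1)[of k] m(2)[of k] \<open>\<nu> > 0\<close> by (intro divide_left_mono) auto
      then have "\<eta>\<^sub>a * (\<nu> / (c\<epsilon> + \<nu>)) * ?t * norm (F (x k))
          \<le> \<eta>\<^sub>a * (\<nu> / (m k + \<nu>)) * ?t * norm (F (x k))"
        using t(1)[of k] by (intro mult_right_mono mult_left_mono) (auto simp: \<eta>\<^sub>a_def)
      also have "\<dots> = \<eta>\<^sub>a * (?t * \<nu> / (m k + \<nu>) * norm (F (x k)))"
        by (simp add: field_simps)
      also have "\<dots> \<le> norm (F (x k)) - norm (F (x k + ?t *\<^sub>R sP k))"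
        using that t nz \<open>\<nu> > 0\<close> m(1) unfolding accepted_def \<rho> s
        by (intro actual_reduction_bound[where F = F and J = J and x = "x k", OF m(3) bound])
           (auto simp: \<eta>\<^sub>a_def)
      finally show ?thesis
        using that by (simp add: x s)
    qed
    show "norm (F (x (Suc k))) = norm (F (x k))" if "\<not> accepted (\<rho> k)"
      using that by (simp add: x)
  qed (use pos nz L \<open>\<nu> > 0\<close> \<open>c\<epsilon> > 0\<close> upd in \<open>auto simp: \<eta>\<^sub>a_def\<close>)
  then have "(\<lambda>k. ereal (norm (F (x k)))) \<longlonglongrightarrow> ereal 0"
    by simp
  then show ?thesis
    by (simp add: lim_imp_Liminf zero_ereal_def)
qed

end
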